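(* Let $1\leq\xi<\omega_1$. Then there exists a partial map $f:\omega^\omega\rightarrow\omega^\omega$ such that the complement $(\omega^\omega\times\omega^\omega)\setminus\mathrm{Gr}(f)$ of the graph of $f$ is ${\bf\Pi}^0_2$ in $\omega^\omega\times\omega^\omega$, but is not in $({\bf\Sigma}^0_\xi\times\mathrm{Borel})_\sigma$, i.e. it cannot be written as $\bigcup_{n\in\omega}C_n\times D_n$ with each $C_n$ a ${\bf\Sigma}^0_\xi$ subset of $\omega^\omega$ and each $D_n$ a Borel subset of $\omega^\omega$.
   Context: $\omega^\omega$ carries the usual product topology (Baire space). A partial map is a map defined on a subset of $\omega^\omega$; $\mathrm{Gr}(f)=\{(x,f(x)) : x\in\mathrm{dom}(f)\}$. *)

theory Defs
  imports "HOL-Analysis.Analysis" "HOL-Library.Countable_Set_Type"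
begin

section \<open>The countable ordinals\<close>

text \<open>
  \<open>cardSuc natLeq\<close> is a well-order of type \<open>\<omega>\<^sub>1\<close>, so the elements of its field
  are exactly the ordinals below \<open>\<omega>\<^sub>1\<close>. Up to isomorphism, the resulting type is the only
  uncountable well-order all of whose proper initial segments are countable; see the lemmas
  \<open>countable_below\<close> and \<open>uncountable_omega1\<close>.
\<close>

lemma Card_order_omega1: "Card_order (cardSuc natLeq)"
  by (simp add: cardSuc_Card_order natLeq_Card_order)

lemma infinite_Field_omega1: "infinite (Field (cardSuc natLeq))"
  using cardSuc_finite[OF natLeq_Card_order] by (simp add: Field_natLeq)

lemma wo_rel_omega1: "wo_rel (cardSuc natLeq)"
  using Card_order_omega1 by (simp add: card_order_on_well_order_on wo_rel_def)

typedef omega1 = "Field (cardSuc natLeq)"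
  using infinite_Field_omega1 by (metis finite.emptyI ex_in_conv)

instantiation omega1 :: wellorder
begin

definition less_eq_omega1 :: "omega1 \<Rightarrow> omega1 \<Rightarrow> bool" where
  "x \<le> y \<longleftrightarrow> (Rep_omega1 x, Rep_omega1 y) \<in> cardSuc natLeq"

definition less_omega1 :: "omega1 \<Rightarrow> omega1 \<Rightarrow> bool" where
  "(x :: omega1) < y \<longleftrightarrow> x \<le> y \<and> x \<noteq> y"

instance
proof
  let ?r = "cardSuc natLeq"
  note R = Rep_omega1
  have anti: "x = y" if "x \<le> y" "y \<le> x" for x y :: omega1
    using that wo_rel.ANTISYM[OF wo_rel_omega1]
    unfolding less_eq_omega1_def antisym_def by (metis Rep_omega1_inject)
  show "x < y \<longleftrightarrow> x \<le> y \<and> \<not> y \<le> x" for x y :: omega1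
    using anti unfolding less_omega1_def by blast
  show "x \<le> x" for x :: omega1
    using wo_rel.REFL[OF wo_rel_omega1] R unfolding less_eq_omega1_def refl_on_def by blast
  show "x \<le> z" if "x \<le> y" "y \<le> z" for x y z :: omega1
    using that wo_rel.TRANS[OF wo_rel_omega1] unfolding less_eq_omega1_def trans_def by blast
  show "x = y" if "x \<le> y" "y \<le> x" for x y :: omega1
    using anti that .
  show "x \<le> y \<or> y \<le> x" for x y :: omega1
    using wo_rel.TOTALS[OF wo_rel_omega1] R unfolding less_eq_omega1_def by blast
  show "P a" if step: "\<And>x. (\<And>y. y < x \<Longrightarrow> P y) \<Longrightarrow> P x" for P and a :: omega1
  proof -
    have "wf (inv_image (?r - Id) Rep_omega1)"
      using wo_rel.WF[OF wo_rel_omega1] by (rule wf_inv_image)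
    then show ?thesis
    proof (induction a rule: wf_induct_rule)
      case (less x)
      show ?case
        by (rule step, rule less)
          (auto simp: less_omega1_def less_eq_omega1_def Rep_omega1_inject)
    qed
  qed
qed

end

instantiation omega1 :: zero
begin
definition zero_omega1 :: omega1 where "0 = (LEAST x :: omega1. True)"
instance ..
end

definition osuc :: "omega1 \<Rightarrow> omega1" where
  "osuc x = (LEAST y. x < y)"

instantiation omega1 :: one
begin
definition one_omega1 :: omega1 where "(1 :: omega1) = osuc 0"
instance ..
end

lemma zero_le_omega1 [simp]: "0 \<le> (x :: omega1)"
  by (simp add: zero_omega1_def Least_le)

lemma no_max_omega1: "\<exists>y. (x :: omega1) < y"
proof -
  obtain b where b: "b \<in> Field (cardSuc natLeq)" "Rep_omega1 x \<noteq> b"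
      "(Rep_omega1 x, b) \<in> cardSuc natLeq"
    using infinite_Card_order_limit[OF Card_order_omega1 infinite_Field_omega1 Rep_omega1, of x]
    by blast
  then have "x < Abs_omega1 b"
    by (auto simp: less_omega1_def less_eq_omega1_def Abs_omega1_inverse)
  then show ?thesis ..
qed

lemma less_osuc: "x < osuc x"
  unfolding osuc_def using no_max_omega1 by (rule LeastI_ex)

lemma osuc_le_iff: "osuc x \<le> y \<longleftrightarrow> x < y"
  using less_osuc less_le_trans Least_le unfolding osuc_def by metis

lemma less_osuc_iff: "x < osuc y \<longleftrightarrow> x \<le> y"
  using osuc_le_iff[of y x] by (simp add: linorder_not_le[symmetric])

lemma countable_below:
  includes cardinal_syntax
  shows "countable {..< x :: omega1}"
proof -
  have "|underS (cardSuc natLeq) (Rep_omega1 x)| <o cardSuc natLeq"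
    using Card_order_omega1 Rep_omega1 by (rule card_of_underS)
  then have "countable (underS (cardSuc natLeq) (Rep_omega1 x))"
    by (simp add: countable_card_le_natLeq cardSuc_ordLeq_ordLess natLeq_Card_order
        card_of_Card_order)
  moreover have "Rep_omega1 ` {..<x} \<subseteq> underS (cardSuc natLeq) (Rep_omega1 x)"
    by (auto simp: underS_def less_omega1_def less_eq_omega1_def Rep_omega1_inject)
  ultimately have "countable (Rep_omega1 ` {..<x})"
    by (rule countable_subset[rotated])
  then show ?thesis
    by (rule countable_image_inj_on) (simp add: inj_on_def Rep_omega1_inject)
qed

lemma uncountable_omega1:
  includes cardinal_syntax
  shows "\<not> countable (UNIV :: omega1 set)"
proof
  assume "countable (UNIV :: omega1 set)"
  then have "countable (range Rep_omega1)" by (rule countable_image)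
  then have "countable (Field (cardSuc natLeq))"
    by (simp add: type_definition.Rep_range[OF type_definition_omega1])
  then have "|Field (cardSuc natLeq)| \<le>o natLeq"
    by (simp add: countable_card_le_natLeq)
  then have "|Field (cardSuc natLeq)| <o cardSuc natLeq"
    by (simp add: cardSuc_ordLeq_ordLess natLeq_Card_order card_of_Card_order)
  then show False
    using card_of_Field_ordIso[OF Card_order_omega1] not_ordLess_ordIso by blast
qed

section \<open>The Borel hierarchy\<close>

text \<open>
  \<open>Sigma0 \<xi> A\<close> says that \<open>A\<close> is \<open>\<Sigma>\<^sup>0\<^sub>\<xi>\<close>; the levels start at \<open>1\<close>, and \<open>Sigma0 0\<close> is
  empty. In the second rule, \<open>A n\<close> is \<open>\<Pi>\<^sup>0\<close> at level \<open>\<eta> n\<close>, as \<open>- A n\<close> is \<open>\<Sigma>\<^sup>0\<close> at that level.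
\<close>

inductive Sigma0 :: "omega1 \<Rightarrow> 'a :: topological_space set \<Rightarrow> bool" where
  Sigma0_open: "open A \<Longrightarrow> Sigma0 1 A"
| Sigma0_Union: "\<lbrakk>1 < \<xi>; \<And>n :: nat. 1 \<le> \<eta> n \<and> \<eta> n < \<xi> \<and> Sigma0 (\<eta> n) (- A n)\<rbrakk>
    \<Longrightarrow> Sigma0 \<xi> (\<Union>n. A n)"

definition Pi0 :: "omega1 \<Rightarrow> 'a :: topological_space set \<Rightarrow> bool" where
  "Pi0 \<xi> A \<longleftrightarrow> Sigma0 \<xi> (- A)"

lemma Sigma0_one_iff: "Sigma0 1 A \<longleftrightarrow> open A"
  by (auto intro: Sigma0_open elim: Sigma0.cases)

lemma Sigma0_iff:
  assumes "1 < \<xi>"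
  shows "Sigma0 \<xi> A \<longleftrightarrow>
    (\<exists>B \<eta>. A = (\<Union>n :: nat. B n) \<and> (\<forall>n. 1 \<le> \<eta> n \<and> \<eta> n < \<xi> \<and> Pi0 (\<eta> n) (B n)))"
proof
  assume "Sigma0 \<xi> A"
  then show "\<exists>B \<eta>. A = (\<Union>n :: nat. B n) \<and> (\<forall>n. 1 \<le> \<eta> n \<and> \<eta> n < \<xi> \<and> Pi0 (\<eta> n) (B n))"
    using assms unfolding Pi0_def by cases auto
qed (use assms in \<open>auto simp: Pi0_def intro: Sigma0_Union\<close>)

lemma Sigma0_two_iff: "Sigma0 (osuc 1) A \<longleftrightarrow> fsigma A"
proof -
  have lv: "1 \<le> x \<and> x < osuc 1 \<longleftrightarrow> x = 1" for x
    by (auto simp: less_osuc_iff)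
  have "Sigma0 (osuc 1) A \<longleftrightarrow> (\<exists>B. A = (\<Union>n :: nat. B n) \<and> (\<forall>n. Pi0 1 (B n)))"
    (is "_ \<longleftrightarrow> ?R")
  proof
    assume "Sigma0 (osuc 1) A"
    then obtain B \<eta> where B: "A = (\<Union>n :: nat. B n)"
        "\<forall>n. 1 \<le> \<eta> n \<and> \<eta> n < osuc 1 \<and> Pi0 (\<eta> n) (B n)"
      unfolding Sigma0_iff[OF less_osuc] by blast
    moreover have "\<eta> n = 1" for n
      using B(2) lv by blast
    ultimately show ?R by auto
  next
    assume ?R
    then obtain B where "A = (\<Union>n :: nat. B n)" "\<forall>n. Pi0 1 (B n)" by blast
    then show "Sigma0 (osuc 1) A"
      unfolding Sigma0_iff[OF less_osuc] using less_osuc[of 1]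
      by (intro exI[of _ B] exI[of _ "\<lambda>_. 1"]) simp
  qed
  also have "\<dots> \<longleftrightarrow> fsigma A"
    by (auto simp: fsigma.simps Pi0_def Sigma0_one_iff closed_def)
  finally show ?thesis .
qed

lemma Pi0_two_iff: "Pi0 (osuc 1) A \<longleftrightarrow> gdelta A"
  by (metis Pi0_def Sigma0_two_iff gdelta_complement double_complement)

end

theory Submission
  imports Defs
begin

text \<open>
  Call continuous injections \<open>v\<close>, \<open>u\<close> with disjoint ranges twins at level \<open>\<eta>\<close> if
  a \<open>\<Sigma>\<^sup>0\<^sub>\<eta>\<close> set with comeager preimage under \<open>v\<close> has nonmeager preimage under \<open>u\<close>.
  Let \<open>(v\<^sub>m, u\<^sub>m)\<close> be a sequence of twins in which every level below \<open>\<xi>\<close> occurs infinitely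
  often, put \<open>g(z) = (u\<^sub>m(z\<^sub>m))\<^sub>m\<close>, and let \<open>g\<^sub>j(z)\<close> arise from \<open>g(z)\<close> by replacing its
  \<open>j\<close>-th coordinate with \<open>v\<^sub>j(z\<^sub>j)\<close>. If a \<open>\<Sigma>\<^sup>0\<^sub>\<xi>\<close> set has \<open>g\<close>-preimage comeager in an open
  set \<open>V\<close>, then one of its \<open>\<Pi>\<^sup>0\<^sub>\<eta>\<close> pieces has \<open>g\<close>-preimage comeager in a basic open
  \<open>W \<subseteq> V\<close>; choose \<open>j\<close> of level \<open>\<eta>\<close> beyond the coordinates restricted by \<open>W\<close>. By
  Kuratowski--Ulam in coordinate \<open>j\<close>, the \<open>g\<^sub>j\<close>-preimage of that piece is nonmeager in \<open>W\<close>.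
  Hence \<open>g\<close> and the \<open>g\<^sub>j\<close> can be glued to twins at level \<open>\<xi>\<close>, which gives twins at all
  levels by induction.

  The partial map sends \<open>g\<^sub>j(z)\<close> to \<open>z\<close>, so its graph is a countable union of closed sets. If
  its complement were \<open>\<Union>n. C\<^sub>n \<times> D\<^sub>n\<close>, it would contain all pairs \<open>(g(z), z)\<close>, so for some
  \<open>n\<close> and some open \<open>V\<close> we would have \<open>g(z) \<in> C\<^sub>n\<close> and \<open>z \<in> D\<^sub>n\<close> for comeager many
  \<open>z \<in> V\<close>; then \<open>g\<^sub>j(z) \<in> C\<^sub>n\<close> and \<open>z \<in> D\<^sub>n\<close> for some \<open>j\<close> and \<open>z\<close>, a point of the graph.
\<close>

section \<open>Local comeagerness\<close>

text \<open>For open \<open>V\<close> this says that \<open>V - A\<close> is meager. The sets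
  \<open>U n\<close> are open in the whole space, so no subspace topology is involved.\<close>

definition comeager_in :: "'a::topological_space set \<Rightarrow> 'a set \<Rightarrow> bool" where
  "comeager_in V A \<longleftrightarrow>
    (\<exists>U :: nat \<Rightarrow> 'a set. (\<forall>n. open (U n) \<and> V \<subseteq> closure (U n)) \<and> V \<inter> (\<Inter>n. U n) \<subseteq> A)"

lemma comeager_in_mono:
  assumes "comeager_in V A" "V' \<subseteq> V" "A \<inter> V' \<subseteq> A'"
  shows "comeager_in V' A'"
proof -
  obtain U :: "nat \<Rightarrow> 'a set" where U: "\<forall>n. open (U n) \<and> V \<subseteq> closure (U n)"
      and sub: "V \<inter> (\<Inter>n. U n) \<subseteq> A"
    using assms(1) unfolding comeager_in_def by blast
  have "\<forall>n. open (U n) \<and> V' \<subseteq> closure (U n)"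
    using U assms(2) by (meson order_trans)
  moreover have "V' \<inter> (\<Inter>n. U n) \<subseteq> A'"
    using sub assms(2,3) by blast
  ultimately show ?thesis unfolding comeager_in_def by blast
qed

lemma comeager_in_open_dense:
  assumes "open U" "V \<subseteq> closure U"
  shows "comeager_in V U"
  unfolding comeager_in_def using assms by (intro exI[of _ "\<lambda>_. U"]) auto

lemma comeager_in_INT:
  assumes "\<And>n :: nat. comeager_in V (A n)"
  shows "comeager_in V (\<Inter>n. A n)"
proof -
  have "\<forall>n. \<exists>U :: nat \<Rightarrow> 'a set.
      (\<forall>k. open (U k) \<and> V \<subseteq> closure (U k)) \<and> V \<inter> (\<Inter>k. U k) \<subseteq> A n"
    using assms unfolding comeager_in_def by blast
  then obtain U :: "nat \<Rightarrow> nat \<Rightarrow> 'a set" where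
    U: "\<And>n k. open (U n k)" "\<And>n k. V \<subseteq> closure (U n k)" "\<And>n. V \<inter> (\<Inter>k. U n k) \<subseteq> A n"
    by metis
  let ?U = "\<lambda>i. U (fst (prod_decode i)) (snd (prod_decode i))"
  have "V \<inter> (\<Inter>i. ?U i) \<subseteq> (\<Inter>n. A n)"
  proof safe
    fix x n assume x: "x \<in> V" "x \<in> (\<Inter>i. ?U i)"
    have "x \<in> U n k" for k
      using INT_D[OF x(2), of "prod_encode (n, k)"] by simp
    with x(1) U(3) show "x \<in> A n" by blast
  qed
  with U(1,2) show ?thesis
    unfolding comeager_in_def by (intro exI[of _ ?U]) blast
qed

lemma comeager_in_Int:
  assumes "comeager_in V A" "comeager_in V B"
  shows "comeager_in V (A \<inter> B)"
proof -
  have "comeager_in V (\<Inter>n :: nat. if n = 0 then A else B)"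
    using assms by (intro comeager_in_INT) simp
  then show ?thesis
    by (rule comeager_in_mono) (auto dest: spec[of _ 0] spec[of _ 1])
qed

section \<open>The Baire category theorem\<close>

lemma completely_metrizable_space_fun:
  assumes "completely_metrizable_space (euclidean :: 'b::topological_space topology)"
  shows "completely_metrizable_space (euclidean :: ('a::countable \<Rightarrow> 'b) topology)"
  using assms unfolding euclidean_product_topology[symmetric]
  by (simp add: completely_metrizable_space_product_topology)

lemma completely_metrizable_space_Baire2:
  "completely_metrizable_space (euclidean :: (nat \<Rightarrow> nat \<Rightarrow> nat) topology)"
proof -
  have "(euclidean :: nat topology) = discrete_topology UNIV"
    by (rule sym) (simp add: discrete_topology_unique open_discrete)
  then show ?thesis
    by (intro completely_metrizable_space_fun)
       (simp add: completely_metrizable_space_discrete_topology)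
qed

lemma comeager_in_nonempty:
  fixes V :: "'a::topological_space set"
  assumes cm: "completely_metrizable_space (euclidean :: 'a topology)"
    and V: "open V" "V \<noteq> {}" and A: "comeager_in V A"
  shows "V \<inter> A \<noteq> {}"
proof -
  obtain U :: "nat \<Rightarrow> 'a set" where
    U: "\<And>n. open (U n)" "\<And>n. V \<subseteq> closure (U n)" and sub: "V \<inter> (\<Inter>n. U n) \<subseteq> A"
    using A unfolding comeager_in_def by blast
  \<comment> \<open>Each \<open>U n\<close> is dense only in \<open>V\<close>; adding the exterior
    of \<open>V\<close> makes it dense everywhere and changes nothing inside
    \<open>V\<close>.\<close>
  let ?U = "\<lambda>n. U n \<union> - closure V"
  have dense: "closure (?U n) = UNIV" for n
  proof -
    have "closure V \<subseteq> closure (U n)"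
      by (rule closure_minimal[OF U(2)]) simp
    then have "closure (U n) \<union> - closure V = UNIV" by blast
    then show ?thesis
      unfolding closure_Un using closure_subset[of "- closure V"] by blast
  qed
  have "euclidean closure_of (\<Inter>n. ?U n) = topspace (euclidean :: 'a topology)"
    using cm U(1) dense
    by (intro Baire_category) (auto intro!: open_Un open_Compl)
  then have "closure (\<Inter>n. ?U n) = UNIV" by simp
  then have "V \<inter> (\<Inter>n. ?U n) \<noteq> {}"
    using V open_Int_closure_eq_empty[of V "\<Inter>n. ?U n"] by simp
  with sub show ?thesis
    using closure_subset[of V] by blast
qed

section \<open>Localization and the Baire property\<close>

text \<open>Choosing a witness inside every basic open subset of \<open>V\<close> gives countably
  many open sets whose union is dense in \<open>V\<close>. In each of them \<open>A\<close> misses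
  only a meager set, and countably many meager sets have a meager union.\<close>

lemma comeager_in_local:
  fixes V :: "'a::second_countable_topology set"
  assumes V: "open V"
    and loc: "\<And>W. open W \<Longrightarrow> W \<noteq> {} \<Longrightarrow> W \<subseteq> V \<Longrightarrow>
      \<exists>W'. open W' \<and> W' \<noteq> {} \<and> W' \<subseteq> W \<and> comeager_in W' A"
  shows "comeager_in V A"
proof -
  obtain B :: "'a set set" where B: "countable B" "topological_basis B"
    using ex_countable_basis by blast
  let ?B = "{b \<in> B. b \<noteq> {} \<and> b \<subseteq> V}"
  have "\<forall>b\<in>?B. \<exists>W. open W \<and> W \<noteq> {} \<and> W \<subseteq> b \<and> comeager_in W A"
    using loc topological_basis_open[OF B(2)] by blast
  then obtain W where W: "\<And>b. b \<in> ?B \<Longrightarrow> open (W b) \<and> W b \<noteq> {} \<and> W b \<subseteq> b \<and> comeager_in (W b) A"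
    by metis
  let ?W = "\<Union>b\<in>?B. W b"
  have W_open: "open ?W" using W by blast
  have W_dense: "V \<subseteq> closure ?W"
  proof
    fix x assume x: "x \<in> V"
    show "x \<in> closure ?W"
      unfolding closure_iff_nhds_not_empty
    proof (intro allI impI)
      fix T O' assume T: "O' \<subseteq> T" "open O'" "x \<in> O'"
      then obtain b where b: "b \<in> B" "x \<in> b" "b \<subseteq> O' \<inter> V"
        using topological_basisE[OF B(2), of "O' \<inter> V" x] x V by blast
      with W[of b] show "?W \<inter> T \<noteq> {}"
        using T(1) by blast
    qed
  qed
  \<comment> \<open>The condition for \<open>b\<close> concerns \<open>W b\<close> alone and is void
    outside \<open>?B\<close>, so all of \<open>B\<close> can be enumerated.\<close>
  define A' where "A' b = (if b \<in> ?B then A \<union> - W b else UNIV)" for b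
  have part: "comeager_in V (A' b)" for b
  proof (cases "b \<in> ?B")
    case True
    obtain U :: "nat \<Rightarrow> 'a set" where U: "\<And>n. open (U n)" "\<And>n. W b \<subseteq> closure (U n)"
        and sub: "W b \<inter> (\<Inter>n. U n) \<subseteq> A"
      using W[OF True] unfolding comeager_in_def by blast
    have "V \<subseteq> closure (U n \<union> - closure (W b))" for n
    proof -
      have "closure (W b) \<subseteq> closure (U n)"
        by (rule closure_minimal[OF U(2)]) simp
      then show ?thesis
        unfolding closure_Un using closure_subset[of "- closure (W b)"] by blast
    qed
    moreover have "V \<inter> (\<Inter>n. U n \<union> - closure (W b)) \<subseteq> A \<union> - W b"
      using sub closure_subset[of "W b"] by blast
    ultimately have "comeager_in V (A \<union> - W b)"
      unfolding comeager_in_def using U(1)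
      by (intro exI[of _ "\<lambda>n. U n \<union> - closure (W b)"]) (blast intro: open_Un open_Compl closed_closure)
    then show ?thesis using True unfolding A'_def by simp
  next
    case False
    then show ?thesis
      unfolding A'_def if_not_P[OF False] by (intro comeager_in_open_dense) auto
  qed
  show ?thesis
  proof (cases "B = {}")
    \<comment> \<open>\<open>from_nat_into\<close> needs a nonempty set; with an empty basis,
      \<open>?W\<close> is empty and hence so is \<open>V\<close>.\<close>
    case True
    then show ?thesis
      using W_dense by (intro comeager_in_mono[OF comeager_in_open_dense[of V V]])
        (auto simp: V closure_subset)
  next
    case False
    have "comeager_in V (\<Inter>n. A' (from_nat_into B n))"
      using part by (rule comeager_in_INT)
    then have "comeager_in V (?W \<inter> (\<Inter>n. A' (from_nat_into B n)))"
      using comeager_in_open_dense[OF W_open W_dense] by (intro comeager_in_Int)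
    moreover have "?W \<inter> (\<Inter>n. A' (from_nat_into B n)) \<subseteq> A"
    proof
      fix x assume x: "x \<in> ?W \<inter> (\<Inter>n. A' (from_nat_into B n))"
      then obtain b where b: "b \<in> ?B" "x \<in> W b" by blast
      obtain n where "from_nat_into B n = b"
        using b(1) B(1) from_nat_into_surj by (metis (no_types, lifting) mem_Collect_eq)
      with x have "x \<in> A' b" by blast
      with b show "x \<in> A" unfolding A'_def by (simp split: if_splits)
    qed
    ultimately show ?thesis
      by (elim comeager_in_mono) auto
  qed
qed

text \<open>The Baire property in local form. In the union step, if no \<open>A n\<close> is
  comeager in a nonempty open subset of \<open>V\<close>, then each \<open>- A n\<close> is comeager
  somewhere inside every such subset, hence in \<open>V\<close>.\<close>

lemma borel_locally_decided:
  fixes A :: "'a::second_countable_topology set"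
  assumes "A \<in> sets borel" "open V" "V \<noteq> {}"
  shows "\<exists>W. open W \<and> W \<noteq> {} \<and> W \<subseteq> V \<and> (comeager_in W A \<or> comeager_in W (- A))"
  using assms
proof -
  have "A \<in> sigma_sets UNIV {S. open S}"
    using assms(1) by (simp add: borel_def)
  then show ?thesis
    using assms(2,3)
  proof (induction arbitrary: V)
    case (Basic A)
    then have A: "open A" by simp
    show ?case
    proof (cases "V \<inter> A = {}")
      case True
      then have "V \<inter> closure A = {}"
        using open_Int_closure_eq_empty[OF Basic.prems(1)] by blast
      then have "comeager_in V (- A)"
        using Basic.prems closure_subset[of V] closure_subset[of A]
        by (intro comeager_in_mono[OF comeager_in_open_dense[of V V]]) auto
      with Basic.prems show ?thesis by blast
    next
      case False
      moreover have "comeager_in (V \<inter> A) A"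
        using A by (intro comeager_in_open_dense) (use closure_subset in auto)
      ultimately show ?thesis using A Basic.prems by (intro exI[of _ "V \<inter> A"]) auto
    qed
  next
    case Empty
    then show ?case
      by (intro exI[of _ V]) (auto intro!: comeager_in_open_dense)
  next
    case (Compl A)
    then show ?case by (simp add: Compl_eq_Diff_UNIV[symmetric] disj_commute)
  next
    case (Union A)
    show ?case
    proof (cases "\<exists>n W. open W \<and> W \<noteq> {} \<and> W \<subseteq> V \<and> comeager_in W (A n)")
      case True
      then obtain n W where "open W" "W \<noteq> {}" "W \<subseteq> V" "comeager_in W (A n)" by blast
      moreover from this have "comeager_in W (\<Union>n. A n)"
        by (elim comeager_in_mono) auto
      ultimately show ?thesis by blast
    next
      case False
      have "comeager_in V (- A n)" for n
      proof (rule comeager_in_local[OF Union.prems(1)])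
        fix W assume "open W" "W \<noteq> {}" "W \<subseteq> V"
        with Union.IH[of W n] False
        show "\<exists>W'. open W' \<and> W' \<noteq> {} \<and> W' \<subseteq> W \<and> comeager_in W' (- A n)"
          by (meson order_trans)
      qed
      then have "comeager_in V (\<Inter>n. - A n)" by (rule comeager_in_INT)
      then have "comeager_in V (- (\<Union>n. A n))" by simp
      with Union.prems show ?thesis by blast
    qed
  qed
qed

text \<open>Otherwise every local decision would fall on \<open>- A\<close>, which would then be
  comeager in \<open>V\<close> by \<open>comeager_in_local\<close>.\<close>

lemma borel_nonmeager_localize:
  fixes A :: "'a::second_countable_topology set"
  assumes "A \<in> sets borel" "open V" "\<not> comeager_in V (- A)"
  obtains W where "open W" "W \<noteq> {}" "W \<subseteq> V" "comeager_in W A"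
proof -
  have "\<exists>W. open W \<and> W \<noteq> {} \<and> W \<subseteq> V \<and> comeager_in W A"
  proof (rule ccontr)
    assume neg: "\<not> ?thesis"
    have "comeager_in V (- A)"
    proof (rule comeager_in_local[OF assms(2)])
      fix W assume "open W" "W \<noteq> {}" "W \<subseteq> V"
      with borel_locally_decided[OF assms(1), of W] neg
      show "\<exists>W'. open W' \<and> W' \<noteq> {} \<and> W' \<subseteq> W \<and> comeager_in W' (- A)"
        by (meson order_trans)
    qed
    with assms(3) show False by blast
  qed
  with that show thesis by blast
qed

lemma comeager_in_UN_localize:
  fixes A :: "nat \<Rightarrow> 'a::second_countable_topology set"
  assumes cm: "completely_metrizable_space (euclidean :: 'a topology)"
    and borel: "\<And>n. A n \<in> sets borel" and V: "open V" "V \<noteq> {}"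
    and com: "comeager_in V (\<Union>n. A n)"
  obtains n W where "open W" "W \<noteq> {}" "W \<subseteq> V" "comeager_in W (A n)"
proof -
  have "\<exists>n. \<not> comeager_in V (- A n)"
  proof (rule ccontr)
    assume "\<not> ?thesis"
    then have "comeager_in V (\<Inter>n. - A n)" by (intro comeager_in_INT) blast
    then have "comeager_in V ((\<Union>n. A n) \<inter> (\<Inter>n. - A n))"
      by (rule comeager_in_Int[OF com])
    from comeager_in_nonempty[OF cm V this] show False by blast
  qed
  then obtain n where "\<not> comeager_in V (- A n)" by blast
  from borel_nonmeager_localize[OF borel V(1) this] that show thesis by metis
qed

text \<open>The map \<open>p\<close> is a homeomorphism onto an open set, so it carries nonempty
  open sets to nonempty open sets, and these meet every dense set.\<close>

lemma comeager_in_vimage_open_embedding: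
  fixes p :: "'a::topological_space \<Rightarrow> 'b::topological_space"
  assumes A: "comeager_in UNIV A"
    and p: "continuous_on UNIV p" and q: "continuous_on UNIV q" "\<And>z. q (p z) = z"
    and ran: "open (range p)"
  shows "comeager_in UNIV (p -` A)"
proof -
  obtain U :: "nat \<Rightarrow> 'b set" where
    U: "\<And>n. open (U n)" "\<And>n. closure (U n) = UNIV" and sub: "(\<Inter>n. U n) \<subseteq> A"
    using A unfolding comeager_in_def by auto
  have "closure (p -` U n) = UNIV" for n
  proof -
    have "V \<inter> p -` U n \<noteq> {}" if V: "open V" "V \<noteq> {}" for V
    proof -
      have "open (range p \<inter> q -` V)"
        using ran open_vimage[OF V(1) q(1)] by blast
      moreover have "range p \<inter> q -` V \<noteq> {}"
        using V(2) q(2) by force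
      ultimately have "range p \<inter> q -` V \<inter> U n \<noteq> {}"
        using U(2)[of n] open_Int_closure_eq_empty[of "range p \<inter> q -` V" "U n"] by simp
      then show ?thesis using q(2) by force
    qed
    then have "- closure (p -` U n) = {}"
      using closure_subset[of "p -` U n"] by (metis Compl_disjoint2 closed_closure
          disjoint_eq_subset_Compl double_complement compl_le_compl_iff open_Compl)
    then show ?thesis by blast
  qed
  then show ?thesis
    unfolding comeager_in_def using U(1) sub p
    by (intro exI[of _ "\<lambda>n. p -` U n"]) (auto intro: open_vimage)
qed

section \<open>Sections in one coordinate of a product\<close>

lemma continuous_fun_upd:
  "continuous_on UNIV (\<lambda>t. (x :: 'a \<Rightarrow> 'b::topological_space)(j := t))"
  "continuous_on UNIV (\<lambda>x :: 'a \<Rightarrow> 'b::topological_space. x(j := t))"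
proof -
  have "continuous_on UNIV (\<lambda>t. (x(j := t)) i)" "continuous_on UNIV (\<lambda>x. (x(j := t)) i)" for i
    by (cases "i = j"; simp)+
  then show "continuous_on UNIV (\<lambda>t. x(j := t))" "continuous_on UNIV (\<lambda>x. x(j := t))"
    by - (rule continuous_on_coordinatewise_then_product, assumption)+
qed

text \<open>The easy half of the Kuratowski--Ulam theorem.\<close>

lemma comeager_in_fun_upd:
  fixes W :: "('a::countable \<Rightarrow> 'b::second_countable_topology) set"
  assumes A: "comeager_in W A" and W: "open W"
    and inv: "\<And>x t. x \<in> W \<Longrightarrow> x(j := t) \<in> W"
  shows "comeager_in W {x. comeager_in UNIV {t. x(j := t) \<in> A}}"
proof -
  obtain U :: "nat \<Rightarrow> ('a \<Rightarrow> 'b) set" where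
    U: "\<And>n. open (U n)" "\<And>n. W \<subseteq> closure (U n)" and sub: "W \<inter> (\<Inter>n. U n) \<subseteq> A"
    using A unfolding comeager_in_def by blast
  obtain B :: "'b set set" where B: "countable B" "topological_basis B"
    using ex_countable_basis by blast
  \<comment> \<open>\<open>UNIV\<close> keeps the family nonempty for the enumeration; the empty set
    is removed because no section meets it.\<close>
  define B' where "B' = insert UNIV (B - {{}})"
  have B': "countable B'" "B' \<noteq> {}" using B(1) by (auto simp: B'_def)
  have openB: "open b" "b \<noteq> {}" if "b \<in> B'" for b
    using that topological_basis_open[OF B(2)] by (auto simp: B'_def)
  \<comment> \<open>\<open>x\<close> lies in \<open>D n b\<close> when the section of
    \<open>U n\<close> through \<open>x\<close> in coordinate \<open>j\<close> meets
    \<open>b\<close>; if this holds for all \<open>b\<close>, the section is dense.\<close>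
  define D where "D n b = (\<Union>t\<in>b. (\<lambda>x. x(j := t)) -` U n)" for n b
  have "comeager_in W (D n b)" if b: "b \<in> B'" for n b
  proof (rule comeager_in_open_dense)
    show "open (D n b)"
      unfolding D_def using open_vimage[OF U(1) continuous_fun_upd(2)] by blast
    show "W \<subseteq> closure (D n b)"
    proof (intro subsetI closure_iff_nhds_not_empty[THEN iffD2] allI impI)
      fix x T W' assume x: "x \<in> W" and T: "W' \<subseteq> T" "open W'" "x \<in> W'"
      \<comment> \<open>These points have coordinate \<open>j\<close> in \<open>b\<close>, and a
        change of this coordinate moves them into \<open>W' \<inter> W\<close>. A point of
        \<open>?E\<close> in \<open>U n\<close>, moved in this way, lies in both
        \<open>D n b\<close> and \<open>W'\<close>.\<close>
      let ?E = "(\<lambda>z. z j) -` b \<inter> (\<Union>s. (\<lambda>z. z(j := s)) -` (W' \<inter> W))"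
      have "open ?E"
        using openB(1)[OF b] T(2) W
        by (intro open_Int open_UN ballI)
          (auto intro!: open_vimage continuous_fun_upd(2))
      moreover obtain t where t: "t \<in> b" using openB(2)[OF b] by blast
      moreover have "x(j := t) \<in> ?E"
        using t x T(3) by (auto intro!: exI[of _ "x j"])
      moreover have EW: "?E \<subseteq> W"
      proof
        fix z assume "z \<in> ?E"
        then obtain s where "z(j := s) \<in> W" by blast
        from inv[OF this, of "z j"] show "z \<in> W" by simp
      qed
      ultimately have "?E \<inter> U n \<noteq> {}"
        using U(2)[of n] open_Int_closure_eq_empty[of ?E "U n"] by blast
      then obtain z s where z: "z j \<in> b" "z(j := s) \<in> W'" "z \<in> U n" by blast
      then have "z(j := s) \<in> D n b"
        unfolding D_def by (auto intro!: bexI[of _ "z j"])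
      with z(2) T(1) show "D n b \<inter> T \<noteq> {}" by blast
    qed
  qed
  then have "comeager_in W (D n (from_nat_into B' i))" for n i
    using B'(2) by (simp add: from_nat_into)
  then have "comeager_in W (\<Inter>n. \<Inter>i. D n (from_nat_into B' i))"
    by (intro comeager_in_INT)
  then show ?thesis
  proof (rule comeager_in_mono[OF _ order_refl], intro subsetI CollectI)
    fix x assume x: "x \<in> (\<Inter>n. \<Inter>i. D n (from_nat_into B' i)) \<inter> W"
    have D: "x \<in> D n b" if "b \<in> B'" for n b
      using x from_nat_into_surj[OF B'(1) that] by blast
    have dense: "closure ((\<lambda>t. x(j := t)) -` U n) = UNIV" for n
    proof -
      have "t \<in> closure ((\<lambda>t. x(j := t)) -` U n)" for t
        unfolding closure_iff_nhds_not_empty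
      proof (intro allI impI)
        fix T W' assume T: "W' \<subseteq> T" "open W'" "t \<in> W'"
        obtain b where b: "b \<in> B" "t \<in> b" "b \<subseteq> W'"
          using topological_basisE[OF B(2) T(2,3)] by blast
        then have "b \<in> B'" by (auto simp: B'_def)
        from D[OF this, of n] b(3) T(1)
        show "(\<lambda>t. x(j := t)) -` U n \<inter> T \<noteq> {}" by (auto simp: D_def)
      qed
      then show ?thesis by blast
    qed
    have "\<And>t. x(j := t) \<in> W" using x inv by blast
    with sub have "(\<Inter>n. (\<lambda>t. x(j := t)) -` U n) \<subseteq> {t. x(j := t) \<in> A}" by blast
    then show "comeager_in UNIV {t. x(j := t) \<in> A}"
      unfolding comeager_in_def using dense open_vimage[OF U(1) continuous_fun_upd(1)]
      by (intro exI[of _ "\<lambda>n. (\<lambda>t. x(j := t)) -` U n"]) auto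
  qed
qed

text \<open>A basic open box restricts only finitely many coordinates; \<open>N\<close> bounds
  them.\<close>

lemma open_fun_upd_invariant_nhd:
  fixes V :: "(nat \<Rightarrow> 'b::topological_space) set"
  assumes "open V" "x \<in> V"
  obtains W N where "open W" "x \<in> W" "W \<subseteq> V" "\<And>j y t. N \<le> j \<Longrightarrow> y \<in> W \<Longrightarrow> y(j := t) \<in> W"
proof -
  from assms have "openin (product_topology (\<lambda>i. euclidean) UNIV) V"
    by (simp add: open_fun_def)
  from product_topology_open_contains_basis[OF this assms(2)]
  obtain X where X: "x \<in> (\<Pi>\<^sub>E i\<in>UNIV. X i)" "\<And>i. open (X i)" "finite {i. X i \<noteq> UNIV}"
      "(\<Pi>\<^sub>E i\<in>UNIV. X i) \<subseteq> V"
    by auto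
  obtain N where N: "\<forall>i\<in>{i. X i \<noteq> UNIV}. i < N"
    using X(3) finite_nat_set_iff_bounded by blast
  have "y(j := t) \<in> (\<Pi>\<^sub>E i\<in>UNIV. X i)" if "N \<le> j" "y \<in> (\<Pi>\<^sub>E i\<in>UNIV. X i)" for j y t
  proof -
    have "X j = UNIV" using N that(1) by fastforce
    with that(2) show ?thesis by (auto simp: PiE_iff)
  qed
  with X show thesis
    by (intro that[of "\<Pi>\<^sub>E i\<in>UNIV. X i" N]) (auto intro: open_PiE)
qed

section \<open>Borel classes\<close>

lemma Sigma0_ge_1: "Sigma0 \<xi> A \<Longrightarrow> 1 \<le> \<xi>"
  by (induction rule: Sigma0.induct) auto

lemma zero_less_one_omega1: "0 < (1 :: omega1)"
  unfolding one_omega1_def by (rule less_osuc)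

lemma Sigma0_vimage:
  fixes h :: "'a::topological_space \<Rightarrow> 'b::topological_space"
  assumes "Sigma0 \<xi> A" "continuous_on UNIV h"
  shows "Sigma0 \<xi> (h -` A)"
  using assms(1)
proof (induction rule: Sigma0.induct)
  case (Sigma0_open A)
  then show ?case by (intro Sigma0.Sigma0_open open_vimage assms(2))
next
  case (Sigma0_Union \<xi> \<eta> A)
  then have "Sigma0 \<xi> (\<Union>n. h -` A n)"
    by (intro Sigma0.Sigma0_Union[where \<eta> = \<eta>]) (auto simp: vimage_Compl)
  then show ?case by (simp add: vimage_UN)
qed

lemma Sigma0_borel: "Sigma0 \<xi> A \<Longrightarrow> A \<in> sets borel"
proof (induction rule: Sigma0.induct)
  case (Sigma0_Union \<xi> \<eta> A)
  then have "A n \<in> sets borel" for n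
    using borel_comp[of "- A n"] by simp
  then show ?case by blast
qed auto

lemma borel_vimage_continuous:
  assumes "continuous_on UNIV h" "A \<in> sets borel"
  shows "h -` A \<in> sets borel"
  using measurable_sets[OF borel_measurable_continuous_onI[OF assms(1)] assms(2)] by simp

section \<open>Codings of Baire space\<close>

text \<open>Category arguments run in the space of sequences of points of Baire space, where a
  single coordinate is again such a point; \<open>flatten\<close> leads back to Baire space
  itself.\<close>

definition flatten :: "(nat \<Rightarrow> nat \<Rightarrow> 'a) \<Rightarrow> nat \<Rightarrow> 'a" where
  "flatten x n = x (fst (prod_decode n)) (snd (prod_decode n))"

definition unflatten :: "(nat \<Rightarrow> 'a) \<Rightarrow> nat \<Rightarrow> nat \<Rightarrow> 'a" where
  "unflatten y m i = y (prod_encode (m, i))"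

lemma unflatten_flatten [simp]: "unflatten (flatten x) = x"
  by (simp add: flatten_def unflatten_def fun_eq_iff)

lemma flatten_unflatten [simp]: "flatten (unflatten y) = y"
  by (simp add: flatten_def unflatten_def fun_eq_iff)

lemma flatten_eq_iff [simp]: "flatten x = flatten y \<longleftrightarrow> x = y"
  by (metis unflatten_flatten)

lemma unflatten_eq_iff [simp]: "unflatten x = unflatten y \<longleftrightarrow> x = y"
  by (metis flatten_unflatten)

lemma continuous_flatten:
  assumes "continuous_on UNIV h"
  shows "continuous_on UNIV (\<lambda>t. flatten (h t :: nat \<Rightarrow> nat \<Rightarrow> 'b::topological_space))"
  unfolding flatten_def
  by (rule continuous_on_coordinatewise_then_product)
    (rule continuous_on_product_then_coordinatewise[OF
        continuous_on_product_then_coordinatewise[OF assms]])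

lemma continuous_unflatten:
  assumes "continuous_on UNIV h"
  shows "continuous_on UNIV (\<lambda>t. unflatten (h t :: nat \<Rightarrow> 'b::topological_space))"
  unfolding unflatten_def
  by (intro continuous_on_coordinatewise_then_product
      continuous_on_product_then_coordinatewise[OF assms])

lemma continuous_case_nat:
  assumes "continuous_on UNIV a" "continuous_on UNIV h"
  shows "continuous_on UNIV (\<lambda>t. case_nat (a t) (h t) :: nat \<Rightarrow> 'b::topological_space)"
proof (rule continuous_on_coordinatewise_then_product)
  fix i show "continuous_on UNIV (\<lambda>t. case_nat (a t) (h t) i)"
    by (cases i) (simp_all add: assms continuous_on_product_then_coordinatewise)
qed

lemma continuous_shift: "continuous_on UNIV (\<lambda>t n. t (Suc n) :: 'b::topological_space)"
  by (intro continuous_on_coordinatewise_then_product) simp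

text \<open>The fibres of \<open>c\<close> are open, since \<open>nat\<close> is discrete.\<close>

lemma continuous_discrete_parameter:
  fixes F :: "nat \<Rightarrow> 'a::topological_space \<Rightarrow> 'b::topological_space"
  assumes "\<And>k. continuous_on UNIV (F k)" "continuous_on UNIV c"
  shows "continuous_on UNIV (\<lambda>t. F (c t) t)"
proof -
  have "open ((\<lambda>t. F (c t) t) -` U)" if "open U" for U
  proof -
    have "(\<lambda>t. F (c t) t) -` U = (\<Union>k. c -` {k} \<inter> F k -` U)" by auto
    moreover have "open (c -` {k} \<inter> F k -` U)" for k
      using that assms by (intro open_Int open_vimage) (auto simp: open_discrete)
    ultimately show ?thesis by (auto intro: open_UN)
  qed
  then show ?thesis by (simp add: continuous_on_open_vimage)
qed

lemma case_nat_eq_iff: "case_nat a x = case_nat b y \<longleftrightarrow> a = b \<and> x = y"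
  by (metis ext nat.case)

text \<open>The points with head \<open>k\<close> form an open copy of the sequence space.\<close>

lemma comeager_in_vimage_case_nat_flatten:
  fixes A :: "(nat \<Rightarrow> nat) set"
  assumes "comeager_in UNIV A"
  shows "comeager_in UNIV ((\<lambda>z. case_nat k (flatten z)) -` A)"
  using assms
proof (rule comeager_in_vimage_open_embedding)
  let ?p = "\<lambda>z. case_nat k (flatten z)"
  let ?q = "\<lambda>t. unflatten (\<lambda>n. t (Suc n))"
  show "continuous_on UNIV ?p"
    by (intro continuous_case_nat continuous_flatten continuous_intros)
  show "continuous_on UNIV ?q"
    by (intro continuous_unflatten continuous_shift)
  show "?q (?p z) = z" for z by simp
  have "t \<in> range ?p" if "t 0 = k" for t
    by (rule range_eqI[of _ _ "?q t"]) (simp add: fun_eq_iff that split: nat.split)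
  then have "range ?p = (\<lambda>t. t 0) -` {k}" by auto
  then show "open (range ?p)"
    using open_vimage[of "{k}" "\<lambda>t :: nat \<Rightarrow> nat. t 0"] by (simp add: open_discrete)
qed

section \<open>Pairs of maps inseparable at a level\<close>

definition twins :: "omega1 \<Rightarrow> ((nat \<Rightarrow> nat) \<Rightarrow> (nat \<Rightarrow> nat)) \<Rightarrow> ((nat \<Rightarrow> nat) \<Rightarrow> (nat \<Rightarrow> nat)) \<Rightarrow> bool"
  where "twins \<eta> v u \<longleftrightarrow>
    continuous_on UNIV v \<and> continuous_on UNIV u \<and> inj v \<and> inj u \<and> range v \<inter> range u = {} \<and>
    (\<forall>S. Sigma0 \<eta> S \<longrightarrow> comeager_in UNIV (v -` S) \<longrightarrow> \<not> comeager_in UNIV (u -` (- S)))"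

locale twin_sequence =
  fixes v u :: "nat \<Rightarrow> (nat \<Rightarrow> nat) \<Rightarrow> (nat \<Rightarrow> nat)" and e :: "nat \<Rightarrow> omega1" and \<xi> :: omega1
  assumes twins: "twins (e m) (v m) (u m)"
    and recurrent: "\<eta> < \<xi> \<Longrightarrow> \<exists>m\<ge>N. e m = \<eta>"
begin

text \<open>The roles of \<open>u\<close> and \<open>v\<close> alternate from level to level:
  \<open>limit\<close> is made of the \<open>u m\<close> but yields the \<open>v\<close> of the next
  pair, because a \<Sigma> set breaks up into \<Pi> pieces, to which the twin condition applies
  through complements.\<close>

definition limit :: "(nat \<Rightarrow> nat \<Rightarrow> nat) \<Rightarrow> nat \<Rightarrow> nat \<Rightarrow> nat" where
  "limit z m = u m (z m)"

definition branch :: "nat \<Rightarrow> (nat \<Rightarrow> nat \<Rightarrow> nat) \<Rightarrow> nat \<Rightarrow> nat \<Rightarrow> nat" where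
  "branch j z = (limit z)(j := v j (z j))"

lemma twin_inj [simp]: "v m s = v m t \<longleftrightarrow> s = t" "u m s = u m t \<longleftrightarrow> s = t"
  using twins[of m] by (auto simp: twins_def inj_eq)

lemma twin_disjoint [simp]: "v m s \<noteq> u m t" "u m t \<noteq> v m s"
  using twins[of m] unfolding twins_def by (metis disjoint_iff rangeI)+

lemma continuous_limit: "continuous_on UNIV limit"
proof (intro continuous_on_coordinatewise_then_product)
  fix m i
  have "continuous_on UNIV (\<lambda>z. u m (z m))"
    using twins[of m] unfolding twins_def
    by (auto intro: continuous_on_compose2[where g = "u m"])
  then show "continuous_on UNIV (\<lambda>z. limit z m i)"
    unfolding limit_def by (rule continuous_on_product_then_coordinatewise)
qed

lemma continuous_branch: "continuous_on UNIV (branch j)"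
proof (intro continuous_on_coordinatewise_then_product)
  fix m i
  have "continuous_on UNIV (\<lambda>z. v j (z j))"
    using twins[of j] unfolding twins_def
    by (auto intro: continuous_on_compose2[where g = "v j"])
  then have "continuous_on UNIV (\<lambda>z. if m = j then v j (z j) i else limit z m i)"
    using continuous_on_product_then_coordinatewise[of UNIV "\<lambda>z. v j (z j)" i]
      continuous_on_product_then_coordinatewise[OF
        continuous_on_product_then_coordinatewise[OF continuous_limit], of m i]
    by (cases "m = j") simp_all
  then show "continuous_on UNIV (\<lambda>z. branch j z m i)"
    unfolding branch_def by (simp add: fun_upd_def if_distribR)
qed

lemma inj_limit: "limit z = limit y \<longleftrightarrow> z = y"
  by (auto simp: fun_eq_iff[of "limit z"] limit_def fun_eq_iff[of z y])

lemma limit_neq_branch: "limit z \<noteq> branch j y"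
proof
  assume "limit z = branch j y"
  then have "limit z j = branch j y j" by simp
  then show False by (simp add: limit_def branch_def)
qed

lemma inj_branch: "branch j z = branch k y \<longleftrightarrow> j = k \<and> z = y"
proof
  assume eq: "branch j z = branch k y"
  have "branch j z j = branch k y j" using eq by simp
  \<comment> \<open>Coordinate \<open>j\<close> of \<open>branch j z\<close> lies in the range of
    \<open>v j\<close>; were \<open>k\<close> different from \<open>j\<close>, that of
    \<open>branch k y\<close> would lie in the range of \<open>u j\<close>.\<close>
  then have jk: "j = k" by (auto simp: branch_def limit_def split: if_splits)
  have "z m = y m" for m
    using fun_cong[OF eq, of m] jk by (auto simp: branch_def limit_def split: if_splits)
  with jk show "j = k \<and> z = y" by auto
qed simp

lemma branch_fun_upd: "branch j (x(j := t)) = (limit x)(j := v j t)"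
  by (auto simp: branch_def limit_def fun_eq_iff)

lemma limit_fun_upd: "limit (x(j := t)) = (limit x)(j := u j t)"
  by (auto simp: limit_def fun_eq_iff)

text \<open>
  If a set at a lower level \<open>e j\<close> separated the images of \<open>limit\<close> and \<open>branch j\<close>, then so would
  one of its sections in coordinate \<open>j\<close> separate the images of \<open>u j\<close> and \<open>v j\<close>.
\<close>

lemma limit_branch_inseparable:
  assumes T: "Sigma0 (e j) T" and W: "open W" "W \<noteq> {}"
    and inv: "\<And>x t. x \<in> W \<Longrightarrow> x(j := t) \<in> W"
    and lim: "comeager_in W (limit -` (- T))"
  shows "\<not> comeager_in W (branch j -` T)"
proof
  assume "comeager_in W (branch j -` T)"
  \<comment> \<open>Both comeagerness assumptions pass to the sections through one common point
    \<open>x\<close>.\<close>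
  from comeager_in_Int[OF comeager_in_fun_upd[OF this W(1) inv] comeager_in_fun_upd[OF lim W(1) inv]]
  obtain x where x: "comeager_in UNIV {t. branch j (x(j := t)) \<in> T}"
      "comeager_in UNIV {t. limit (x(j := t)) \<in> - T}"
    using comeager_in_nonempty[OF completely_metrizable_space_Baire2 W] by fastforce
  \<comment> \<open>Outside coordinate \<open>j\<close>, both maps agree with \<open>limit x\<close>
    at all points \<open>x(j := t)\<close>, so one section of \<open>T\<close> serves both.\<close>
  let ?S = "(\<lambda>t. (limit x)(j := t)) -` T"
  have "Sigma0 (e j) ?S"
    by (intro Sigma0_vimage[OF T] continuous_fun_upd)
  moreover have "comeager_in UNIV (v j -` ?S)" "comeager_in UNIV (u j -` (- ?S))"
    using x by (simp_all add: branch_fun_upd limit_fun_upd vimage_def Compl_eq)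
  ultimately show False
    using twins[of j] unfolding twins_def by blast
qed

lemma Sigma0_limit_branch:
  assumes S: "Sigma0 \<xi> S" and V: "open V" "V \<noteq> {}" and lim: "comeager_in V (limit -` S)"
  shows "\<exists>k. \<not> comeager_in V (branch k -` (- S))"
  using S
proof cases
  case Sigma0_open
  obtain z where z: "z \<in> V" "limit z \<in> S"
    using comeager_in_nonempty[OF completely_metrizable_space_Baire2 V lim] by blast
  \<comment> \<open>As \<open>k\<close> grows, \<open>branch k z\<close> converges to
    \<open>limit z\<close>, so the open set \<open>S\<close> contains some branch.\<close>
  obtain W k where W: "W \<subseteq> S" "limit z \<in> W" "\<And>j y t. k \<le> j \<Longrightarrow> y \<in> W \<Longrightarrow> y(j := t) \<in> W"
    using open_fun_upd_invariant_nhd[OF \<open>open S\<close> z(2)] by metis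
  have "branch k z \<in> S"
    unfolding branch_def using W by blast
  then have ne: "V \<inter> branch k -` S \<noteq> {}" using z(1) by blast
  have op: "open (V \<inter> branch k -` S)"
    using open_vimage[OF \<open>open S\<close> continuous_branch] V(1) by blast
  have "\<not> comeager_in V (branch k -` (- S))"
  proof
    assume "comeager_in V (branch k -` (- S))"
    then have "comeager_in (V \<inter> branch k -` S) (branch k -` (- S))"
      by (elim comeager_in_mono) auto
    from comeager_in_nonempty[OF completely_metrizable_space_Baire2 op ne this] show False by auto
  qed
  then show ?thesis ..
next
  case (Sigma0_Union \<eta> P)
  have P: "Sigma0 (\<eta> n) (- P n)" "\<eta> n < \<xi>" for n using Sigma0_Union by auto
  have "P n \<in> sets borel" for n
    using borel_comp[OF Sigma0_borel[OF P(1)], of n] by simp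
  then have "limit -` P n \<in> sets borel" for n
    by (intro borel_vimage_continuous continuous_limit)
  moreover have "comeager_in V (\<Union>n. limit -` P n)"
    using lim unfolding Sigma0_Union by (simp add: vimage_UN)
  ultimately obtain n W where W: "open W" "W \<noteq> {}" "W \<subseteq> V" "comeager_in W (limit -` P n)"
    using comeager_in_UN_localize[OF completely_metrizable_space_Baire2 _ V] by metis
  then obtain x where "x \<in> W" by blast
  from open_fun_upd_invariant_nhd[OF W(1) this]
  obtain W' N where W': "open W'" "x \<in> W'" "W' \<subseteq> W"
      "\<And>j y t. N \<le> j \<Longrightarrow> y \<in> W' \<Longrightarrow> y(j := t) \<in> W'"
    by metis
  obtain j where j: "N \<le> j" "e j = \<eta> n" using recurrent[OF P(2)] by blast
  \<comment> \<open>\<open>P n\<close> is \<Pi> at level \<open>e j\<close>, so inseparability is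
    applied to its complement, a \<Sigma> set.\<close>
  have "\<not> comeager_in W' (branch j -` (- P n))"
  proof (rule limit_branch_inseparable)
    show "comeager_in W' (limit -` (- (- P n)))"
      using W(4) W'(3) by (auto elim: comeager_in_mono)
  qed (use P W' j in auto)
  moreover have "comeager_in W' (branch j -` (- P n))" if "comeager_in V (branch j -` (- S))"
    using that W(3) W'(3) Sigma0_Union(1) by (elim comeager_in_mono) auto
  ultimately show ?thesis by blast
qed

text \<open>The head \<open>t 0\<close> selects the branch in \<open>?u\<close>, which glues all
  branches into one map. In \<open>?v\<close> it is copied to the output for injectivity. As
  \<open>?u\<close> always outputs head 0, only the slice of \<open>S\<close> with head 0 is
  compared.\<close>

lemma twins_limit_branch:
  "twins \<xi> (\<lambda>t. case_nat (t 0) (flatten (limit (unflatten (\<lambda>n. t (Suc n))))))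
    (\<lambda>t. case_nat 0 (flatten (branch (t 0) (unflatten (\<lambda>n. t (Suc n))))))"
    (is "twins \<xi> ?v ?u")
  unfolding twins_def
proof (intro conjI allI impI notI)
  have q: "continuous_on UNIV (\<lambda>t :: nat \<Rightarrow> nat. unflatten (\<lambda>n. t (Suc n)))"
    by (intro continuous_unflatten continuous_shift)
  show "continuous_on UNIV ?v"
    using continuous_on_compose2[OF continuous_limit q]
    by (intro continuous_case_nat continuous_flatten) auto
  have "continuous_on UNIV (\<lambda>t. branch k (unflatten (\<lambda>n. t (Suc n))))" for k
    by (rule continuous_on_compose2[OF continuous_branch q]) simp
  from continuous_discrete_parameter[OF this, of "\<lambda>t. t 0"]
  have "continuous_on UNIV (\<lambda>t. branch (t 0) (unflatten (\<lambda>n. t (Suc n))))" by simp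
  then show "continuous_on UNIV ?u"
    by (rule continuous_case_nat[OF continuous_on_const continuous_flatten])
  have eq: "s = t" if "s 0 = t 0" "(\<lambda>n. s (Suc n)) = (\<lambda>n. t (Suc n))" for s t :: "nat \<Rightarrow> nat"
    using that by (metis ext not0_implies_Suc)
  show "inj ?v"
    by (rule injI, rule eq) (simp_all add: case_nat_eq_iff inj_limit)
  show "inj ?u"
    by (rule injI, rule eq) (simp_all add: case_nat_eq_iff inj_branch)
  show "range ?v \<inter> range ?u = {}"
    using limit_neq_branch by (auto simp: case_nat_eq_iff)
  fix S assume S: "Sigma0 \<xi> S" and com: "comeager_in UNIV (?v -` S)" "comeager_in UNIV (?u -` (- S))"
  let ?S = "(\<lambda>x. case_nat 0 (flatten x)) -` S"
  have "Sigma0 \<xi> ?S"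
    by (intro Sigma0_vimage[OF S] continuous_case_nat continuous_flatten continuous_intros)
  moreover have "comeager_in UNIV (limit -` ?S)"
    using comeager_in_vimage_case_nat_flatten[OF com(1), of 0] by (simp add: vimage_def)
  ultimately obtain k where "\<not> comeager_in UNIV (branch k -` (- ?S))"
    using Sigma0_limit_branch[OF _ open_UNIV] by blast
  moreover have "comeager_in UNIV (branch k -` (- ?S))"
    using comeager_in_vimage_case_nat_flatten[OF com(2), of k] by (simp add: vimage_def Compl_eq)
  ultimately show False by blast
qed

end

text \<open>No set is at level \<open>0\<close>; this pair only serves as a filler when there are no lower levels.\<close>

lemma twins_zero: "twins 0 (case_nat 0) (case_nat 1)"
proof -
  have "\<not> Sigma0 0 S" for S :: "(nat \<Rightarrow> nat) set"
    using Sigma0_ge_1[of 0 S] zero_less_one_omega1 by auto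
  moreover have "continuous_on UNIV (case_nat k :: (nat \<Rightarrow> nat) \<Rightarrow> _)" for k :: nat
    by (intro continuous_case_nat continuous_intros)
  ultimately show ?thesis
    unfolding twins_def by (auto simp: inj_def case_nat_eq_iff)
qed

section \<open>Existence at all levels by transfinite induction\<close>

lemma twin_sequence_exists:
  assumes "\<And>\<eta>. \<eta> < \<xi> \<Longrightarrow> \<exists>v u. twins \<eta> v u"
  shows "\<exists>v u e. twin_sequence v u e \<xi>"
proof -
  \<comment> \<open>The added \<open>0\<close> keeps the set nonempty for
    \<open>from_nat_into\<close> when \<open>\<xi> = 0\<close>.\<close>
  let ?E = "insert 0 {..<\<xi>}"
  have "\<forall>\<eta>\<in>?E. \<exists>v u. twins \<eta> v u"
    using assms twins_zero by blast
  then obtain v u where vu: "\<And>\<eta>. \<eta> \<in> ?E \<Longrightarrow> twins \<eta> (v \<eta>) (u \<eta>)" by metis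
  \<comment> \<open>The first component of the decoded pair takes every value infinitely often,
    which gives recurrence.\<close>
  define e where "e m = from_nat_into ?E (fst (prod_decode m))" for m
  have "twin_sequence (\<lambda>m. v (e m)) (\<lambda>m. u (e m)) e \<xi>"
  proof
    show "twins (e m) (v (e m)) (u (e m))" for m
      unfolding e_def by (intro vu from_nat_into) simp
    fix \<eta> N assume "\<eta> < \<xi>"
    then obtain i where "from_nat_into ?E i = \<eta>"
      using from_nat_into_surj[of ?E \<eta>] countable_below[of \<xi>] by auto
    then have "e (prod_encode (i, N)) = \<eta>" by (simp add: e_def)
    moreover have "N \<le> prod_encode (i, N)" by (rule le_prod_encode_2)
    ultimately show "\<exists>m\<ge>N. e m = \<eta>" by blast
  qed
  then show ?thesis by blast
qed

lemma twins_exist: "\<exists>v u. twins \<xi> v u"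
proof (induction \<xi> rule: less_induct)
  case (less \<xi>)
  then obtain v u e where "twin_sequence v u e \<xi>"
    using twin_sequence_exists by blast
  from twin_sequence.twins_limit_branch[OF this] show ?case by blast
qed

section \<open>The partial map\<close>

context twin_sequence
begin

text \<open>By \<open>inj_branch\<close>, a coded branch point determines both \<open>k\<close> and
  \<open>y\<close>, so \<open>THE\<close> is well defined.\<close>

definition index_map :: "(nat \<Rightarrow> nat) \<rightharpoonup> (nat \<Rightarrow> nat)" where
  "index_map x = (if \<exists>y k. x = flatten (branch k (unflatten y))
    then Some (THE y. \<exists>k. x = flatten (branch k (unflatten y))) else None)"

lemma graph_index_map:
  "Map.graph index_map = (\<Union>k. {(x, y). x = flatten (branch k (unflatten y))})"
proof -
  have "(THE y'. \<exists>k'. flatten (branch k (unflatten y)) = flatten (branch k' (unflatten y'))) = y"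
    for k y
    by (rule the_equality) (auto simp: inj_branch)
  then show ?thesis
    by (auto simp: Map.graph_def index_map_def inj_branch split: if_splits)
qed

text \<open>For each \<open>k\<close> the piece of the graph is the transposed graph of a continuous
  map into a Hausdorff space, hence closed.\<close>

lemma Pi0_graph_index_map: "Pi0 (osuc 1) (- Map.graph index_map)"
proof -
  have "closed {(x, y). x = flatten (branch k (unflatten y))}" for k
  proof -
    have c: "continuous_on UNIV (\<lambda>y. flatten (branch k (unflatten y)))"
      using continuous_on_compose2[OF continuous_branch continuous_unflatten[OF continuous_on_id]]
      by (intro continuous_flatten) auto
    have "closed {p. fst p i = flatten (branch k (unflatten (snd p))) i}" for i
    proof (rule closed_Collect_eq)
      show "continuous_on UNIV (\<lambda>p :: (nat \<Rightarrow> nat) \<times> (nat \<Rightarrow> nat). fst p i)"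
        by (rule continuous_on_product_then_coordinatewise) (intro continuous_intros)
      show "continuous_on UNIV (\<lambda>p :: (nat \<Rightarrow> nat) \<times> (nat \<Rightarrow> nat).
          flatten (branch k (unflatten (snd p))) i)"
        by (rule continuous_on_product_then_coordinatewise, rule continuous_on_compose2[OF c])
          (auto intro: continuous_intros)
    qed
    then have "closed {p. \<forall>i. fst p i = flatten (branch k (unflatten (snd p))) i}"
      by (rule closed_Collect_all)
    moreover have "{p. \<forall>i. fst p i = flatten (branch k (unflatten (snd p))) i} =
        {(x, y). x = flatten (branch k (unflatten y))}"
      by (auto simp: fun_eq_iff)
    ultimately show ?thesis by simp
  qed
  then have "fsigma (Map.graph index_map)"
    unfolding graph_index_map by (intro fsigma.intros) auto
  then show ?thesis
    by (simp add: Pi0_def Sigma0_two_iff)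
qed

lemma graph_index_map_not_rectangles:
  fixes C D :: "nat \<Rightarrow> (nat \<Rightarrow> nat) set"
  assumes C: "\<And>n. Sigma0 \<xi> (C n)" and D: "\<And>n. D n \<in> sets borel"
  shows "- Map.graph index_map \<noteq> (\<Union>n. C n \<times> D n)"
proof
  assume eq: "- Map.graph index_map = (\<Union>n. C n \<times> D n)"
  let ?C = "\<lambda>n. flatten -` C n" and ?D = "\<lambda>n. flatten -` D n"
  have flat: "continuous_on UNIV (flatten :: (nat \<Rightarrow> nat \<Rightarrow> nat) \<Rightarrow> _)"
    by (intro continuous_flatten continuous_intros)
  have C': "Sigma0 \<xi> (?C n)" for n by (intro Sigma0_vimage C flat)
  have "(flatten (limit z), flatten z) \<notin> Map.graph index_map" for z
    unfolding graph_index_map using limit_neq_branch by auto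
  then have "(flatten (limit z), flatten z) \<in> (\<Union>n. C n \<times> D n)" for z
    unfolding eq[symmetric] by blast
  then have "(\<Union>n. limit -` ?C n \<inter> ?D n) = UNIV" by auto
  then have com: "comeager_in UNIV (\<Union>n. limit -` ?C n \<inter> ?D n)"
    by (intro comeager_in_open_dense) auto
  have borel: "limit -` ?C n \<inter> ?D n \<in> sets borel" for n
  proof (rule sets.Int)
    show "limit -` ?C n \<in> sets borel"
      by (rule borel_vimage_continuous[OF continuous_limit Sigma0_borel[OF C']])
    show "?D n \<in> sets borel"
      by (rule borel_vimage_continuous[OF flat D])
  qed
  obtain n V where V: "open V" "V \<noteq> {}" and com: "comeager_in V (limit -` ?C n \<inter> ?D n)"
    by (rule comeager_in_UN_localize[OF completely_metrizable_space_Baire2 borel open_UNIV UNIV_not_empty com])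
  have "comeager_in V (limit -` ?C n)" using com by (elim comeager_in_mono) auto
  from Sigma0_limit_branch[OF C' V this]
  obtain k where k: "\<not> comeager_in V (branch k -` (- ?C n))" by blast
  \<comment> \<open>The rectangle \<open>C n \<times> D n\<close> misses the graph, which contains
    every pair of a coded branch point and its index.\<close>
  have "?D n \<subseteq> branch k -` (- ?C n)"
  proof (intro subsetI vimageI2 ComplI)
    fix z assume "z \<in> ?D n" "branch k z \<in> ?C n"
    then have "(flatten (branch k z), flatten z) \<in> - Map.graph index_map"
      unfolding eq by blast
    then show False unfolding graph_index_map by auto
  qed
  then have "comeager_in V (branch k -` (- ?C n))"
    by (intro comeager_in_mono[OF com]) auto
  with k show False by blast
qed

end

theorem theorem1p1:
  fixes \<xi> :: omega1
  assumes "1 \<le> \<xi>"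
  shows "\<exists>f :: (nat \<Rightarrow> nat) \<rightharpoonup> (nat \<Rightarrow> nat).
    Pi0 (osuc 1) (- Map.graph f) \<and>
    \<not> (\<exists>C D :: nat \<Rightarrow> (nat \<Rightarrow> nat) set.
          (\<forall>n. Sigma0 \<xi> (C n)) \<and> (\<forall>n. D n \<in> sets borel) \<and>
          - Map.graph f = (\<Union>n. C n \<times> D n))"
proof -
  obtain v u e where "twin_sequence v u e \<xi>"
    using twin_sequence_exists twins_exist by blast
  then interpret twin_sequence v u e \<xi> .
  show ?thesis
    using Pi0_graph_index_map graph_index_map_not_rectangles by (intro exI[of _ index_map]) blast
qed

end
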